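(* Consider the impulsive system with constant matrices $$\dot x(t)=Ax(t)+B_cu_c(t)+E_cw_c(t),\ t\in(t_k,t_{k+1}],\ k\ge0;\qquad x(t_k^+)=Jx(t_k)+B_du_d(k)+E_dw_d(k),\ k\ge1;$$ $$z_c(t)=C_cx(t)+D_cu_c(t)+F_cw_c(t);\qquad z_d(k)=C_dx(t_k)+D_du_d(k)+F_dw_d(k),\ k\ge1;\qquad x(0)=x(0^+)=x_0\in\mathbb{R}^n,$$ with $E_c,F_c,E_d,F_d$ nonnegative, and the state-feedback control law $u_c(t)=K_cx(t)$, $u_d(k)=K_dx(t_k)$, $K_c\in\mathbb{R}^{m_c\times n}$, $K_d\in\mathbb{R}^{m_d\times n}$. Assume that there exist matrices $X\in\mathbb{D}^n_{\succ0}$, $U_c\in\mathbb{R}^{m_c\times n}$, $U_d\in\mathbb{R}^{m_d\times n}$ and scalars $\varepsilon,\alpha,\gamma>0$ such that $$AX+B_cU_c+\alpha I_n\ge0,\quad JX+B_dU_d\ge0,\quad C_cX+D_cU_c\ge0,\quad C_dX+D_dU_d\ge0$$ and $$\begin{array}{rl} [AX+B_cU_c]\mathbf 1+E_c\mathbf 1&\le0,\\ {}[JX+B_dU_d-X+\varepsilon I]\mathbf 1+E_d\mathbf 1&\le0,\\ {}[C_cX+D_cU_c]\mathbf 1+F_c\mathbf 1-\gamma\mathbf 1&\le0,\\ {}[C_dX+D_dU_d]\mathbf 1+F_d\mathbf 1-\gamma\mathbf 1&\le0. \end{array}$$ Then, under arbitrary dwell-time, the closed-loop system is asymptotically stable and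 has hybrid $L_\infty\times\ell_\infty$-gain less than $\gamma$ with the controller gains $K_c=U_cX^{-1}$ and $K_d=U_dX^{-1}$.
   Context: Matrix and vector inequalities $\ge,\le$ are componentwise; $\mathbf 1$ is the all-ones vector; $f(t^+)=\lim_{s\downarrow t}f(s)$; $\mathbb{D}^n_{\succ0}$ is the set of $n\times n$ diagonal positive definite matrices. Arbitrary dwell-time: all impulse sequences with $t_0=0$, $t_{k+1}-t_k>0$, $t_k\to\infty$ are considered. Stability refers to $w_c,w_d\equiv0$. The hybrid $L_\infty\times\ell_\infty$-gain of $(w_c,w_d)\mapsto(z_c,z_d)$ is the supremum of $\max\{\|z_c\|_{L_\infty},\|z_d\|_{\ell_\infty}\}$ over inputs with $\max\{\|w_c\|_{L_\infty},\|w_d\|_{\ell_\infty}\}=1$, $x_0=0$, and over all these sequences (vector $\infty$-norm pointwise).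
   Formalization: "Gain less than γ" is proved as "gain at most γ"; the strict bound fails for the non-strict conditions, e.g. scalar A=-1, J=0, F_c=1, other matrices 0, X=ε=α=γ=1, where z_c=w_c and the gain equals γ. *)

theory Defs
  imports "HOL-Analysis.Analysis" "HOL-Probability.Essential_Supremum"
begin

text \<open>
  The order on \<^typ>\<open>real ^ 'n\<close> and \<^typ>\<open>real ^ 'n ^ 'm\<close> is the library's componentwise order, and
  \<^term>\<open>1 :: real ^ 'n\<close> is the all-ones vector.  For matrices, \<^term>\<open>1\<close> would be the all-ones matrix;
  the identity matrix is \<^term>\<open>mat 1\<close>.
\<close>

text \<open>
  Dimensions: \<open>'n\<close> state, \<open>'mc\<close>/\<open>'md\<close> controls, \<open>'pc\<close>/\<open>'pd\<close> disturbances, \<open>'qc\<close>/\<open>'qd\<close> outputs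
  (continuous/discrete).
\<close>

record ('n, 'mc, 'md, 'pc, 'pd, 'qc, 'qd) impulsive_system =
  sys_A  :: "real ^ ('n::finite) ^ 'n"
  sys_Bc :: "real ^ ('mc::finite) ^ 'n"
  sys_Ec :: "real ^ ('pc::finite) ^ 'n"
  sys_J  :: "real ^ 'n ^ 'n"
  sys_Bd :: "real ^ ('md::finite) ^ 'n"
  sys_Ed :: "real ^ ('pd::finite) ^ 'n"
  sys_Cc :: "real ^ 'n ^ ('qc::finite)"
  sys_Dc :: "real ^ 'mc ^ 'qc"
  sys_Fc :: "real ^ 'pc ^ 'qc"
  sys_Cd :: "real ^ 'n ^ ('qd::finite)"
  sys_Dd :: "real ^ 'md ^ 'qd"
  sys_Fd :: "real ^ 'pd ^ 'qd"

definition impulse_times :: "(nat \<Rightarrow> real) \<Rightarrow> bool" where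
  "impulse_times t \<longleftrightarrow>
     t 0 = 0 \<and> (\<forall>k. t (Suc k) - t k > 0) \<and> filterlim t at_top sequentially"

text \<open>
  State trajectories in the sense of Caratheodory: since the inputs are only \<open>L\<^sub>\<infinity>\<close> functions, the
  differential equation on \<open>(t\<^sub>k, t\<^sub>k\<^sub>+\<^sub>1]\<close> is required in integrated form.  This makes \<^term>\<open>x\<close>
  left-continuous at the impulse times, and \<open>x(t\<^sup>+)\<close> is the limit from the right.  Only the
  values of \<^term>\<open>x\<close>, \<^term>\<open>uc\<close>, \<^term>\<open>wc\<close> on \<open>[0, \<infinity>)\<close> and of \<^term>\<open>ud\<close>, \<^term>\<open>wd\<close> at \<open>k \<ge> 1\<close> matter.
\<close>

definition trajectory ::
  "('n::finite, 'mc::finite, 'md::finite, 'pc::finite, 'pd::finite, 'qc::finite, 'qd::finite)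
     impulsive_system \<Rightarrow> (nat \<Rightarrow> real) \<Rightarrow>
   (real \<Rightarrow> real ^ 'mc) \<Rightarrow> (nat \<Rightarrow> real ^ 'md) \<Rightarrow>
   (real \<Rightarrow> real ^ 'pc) \<Rightarrow> (nat \<Rightarrow> real ^ 'pd) \<Rightarrow> (real \<Rightarrow> real ^ 'n) \<Rightarrow> bool" where
  "trajectory S t uc ud wc wd x \<longleftrightarrow>
     (\<forall>k a b. t k < a \<and> a \<le> b \<and> b \<le> t (Suc k) \<longrightarrow>
        ((\<lambda>s. sys_A S *v x s + sys_Bc S *v uc s + sys_Ec S *v wc s)
           has_integral (x b - x a)) {a..b}) \<and>
     (\<forall>k\<ge>1. (x \<longlongrightarrow> sys_J S *v x (t k) + sys_Bd S *v ud k + sys_Ed S *v wd k)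
               (at_right (t k))) \<and>
     (x \<longlongrightarrow> x 0) (at_right 0)"

definition output_c ::
  "('n::finite, 'mc::finite, 'md::finite, 'pc::finite, 'pd::finite, 'qc::finite, 'qd::finite)
     impulsive_system \<Rightarrow>
   (real \<Rightarrow> real ^ 'mc) \<Rightarrow> (real \<Rightarrow> real ^ 'pc) \<Rightarrow> (real \<Rightarrow> real ^ 'n) \<Rightarrow> real \<Rightarrow> real ^ 'qc" where
  "output_c S uc wc x s = sys_Cc S *v x s + sys_Dc S *v uc s + sys_Fc S *v wc s"

definition output_d ::
  "('n::finite, 'mc::finite, 'md::finite, 'pc::finite, 'pd::finite, 'qc::finite, 'qd::finite)
     impulsive_system \<Rightarrow> (nat \<Rightarrow> real) \<Rightarrow>
   (nat \<Rightarrow> real ^ 'md) \<Rightarrow> (nat \<Rightarrow> real ^ 'pd) \<Rightarrow> (real \<Rightarrow> real ^ 'n) \<Rightarrow> nat \<Rightarrow> real ^ 'qd" where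
  "output_d S t ud wd x k = sys_Cd S *v x (t k) + sys_Dd S *v ud k + sys_Fd S *v wd k"

definition feedback_c :: "real ^ 'n ^ 'mc \<Rightarrow> (real \<Rightarrow> real ^ 'n) \<Rightarrow> real \<Rightarrow> real ^ 'mc" where
  "feedback_c Kc x s = Kc *v x s"

definition feedback_d ::
  "real ^ 'n ^ 'md \<Rightarrow> (nat \<Rightarrow> real) \<Rightarrow> (real \<Rightarrow> real ^ 'n) \<Rightarrow> nat \<Rightarrow> real ^ 'md" where
  "feedback_d Kd t x k = Kd *v x (t k)"

definition closed_loop_trajectory ::
  "('n::finite, 'mc::finite, 'md::finite, 'pc::finite, 'pd::finite, 'qc::finite, 'qd::finite)
     impulsive_system \<Rightarrow> real ^ 'n ^ 'mc \<Rightarrow> real ^ 'n ^ 'md \<Rightarrow> (nat \<Rightarrow> real) \<Rightarrow>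
   (real \<Rightarrow> real ^ 'pc) \<Rightarrow> (nat \<Rightarrow> real ^ 'pd) \<Rightarrow> (real \<Rightarrow> real ^ 'n) \<Rightarrow> bool" where
  "closed_loop_trajectory S Kc Kd t wc wd x \<longleftrightarrow>
     trajectory S t (feedback_c Kc x) (feedback_d Kd t x) wc wd x"

text \<open>Lyapunov stability and global attractivity of the origin for zero disturbances, for a given
  sequence of impulse times.\<close>

definition closed_loop_asymptotically_stable ::
  "('n::finite, 'mc::finite, 'md::finite, 'pc::finite, 'pd::finite, 'qc::finite, 'qd::finite)
     impulsive_system \<Rightarrow> real ^ 'n ^ 'mc \<Rightarrow> real ^ 'n ^ 'md \<Rightarrow> (nat \<Rightarrow> real) \<Rightarrow> bool" where
  "closed_loop_asymptotically_stable S Kc Kd t \<longleftrightarrow>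
     (\<forall>e>0. \<exists>d>0. \<forall>x. closed_loop_trajectory S Kc Kd t (\<lambda>_. 0) (\<lambda>_. 0) x \<and> norm (x 0) < d
        \<longrightarrow> (\<forall>s\<ge>0. norm (x s) < e)) \<and>
     (\<forall>x. closed_loop_trajectory S Kc Kd t (\<lambda>_. 0) (\<lambda>_. 0) x \<longrightarrow> (x \<longlongrightarrow> 0) at_top)"

definition Linf_norm :: "(real \<Rightarrow> real ^ 'm::finite) \<Rightarrow> ereal" where
  "Linf_norm f = esssup (lebesgue_on {0..}) (\<lambda>s. ereal (infnorm (f s)))"

definition linf_norm :: "(nat \<Rightarrow> real ^ 'm::finite) \<Rightarrow> ereal" where
  "linf_norm f = (SUP k\<in>{1..}. ereal (infnorm (f k)))"

text \<open>
  The supremum also runs over all impulse time sequences (arbitrary dwell-time).  ``Gain less than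
  \<open>\<gamma>\<close>'' is used in the non-strict sense: the non-strict conditions on \<open>\<gamma>\<close> allow \<open>z\<^sub>c = w\<^sub>c\<close> with
  \<open>\<gamma> = 1\<close>, where the gain equals \<open>\<gamma>\<close>.
\<close>

definition hybrid_gain ::
  "('n::finite, 'mc::finite, 'md::finite, 'pc::finite, 'pd::finite, 'qc::finite, 'qd::finite)
     impulsive_system \<Rightarrow> real ^ 'n ^ 'mc \<Rightarrow> real ^ 'n ^ 'md \<Rightarrow> ereal" where
  "hybrid_gain S Kc Kd =
     Sup {max (Linf_norm (output_c S (feedback_c Kc x) wc x))
              (linf_norm (output_d S t (feedback_d Kd t x) wd x)) | t wc wd x.
            impulse_times t \<and> wc \<in> borel_measurable (lebesgue_on {0..}) \<and>
            max (Linf_norm wc) (linf_norm wd) = 1 \<and>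
            closed_loop_trajectory S Kc Kd t wc wd x \<and> x 0 = 0}"

definition diagonal_posdef :: "real ^ 'n::finite ^ 'n \<Rightarrow> bool" where
  "diagonal_posdef X \<longleftrightarrow>
     (\<forall>i j. i \<noteq> j \<longrightarrow> X $ i $ j = 0) \<and> (\<forall>v. v \<noteq> 0 \<longrightarrow> v \<bullet> (X *v v) > 0)"

end

theory Submission
  imports Defs
begin

text \<open>
  Write \<open>A\<^sub>c = A + B\<^sub>c K\<^sub>c\<close>, \<open>J\<^sub>c = J + B\<^sub>d K\<^sub>d\<close> and \<open>\<xi> = X \<one>\<close>.  Since \<open>X\<close> is diagonal with positive
  entries, right multiplication by \<open>X\<close> scales columns and keeps signs, and \<open>A\<^sub>c X = A X + B\<^sub>c U\<^sub>c\<close>,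
  likewise for the other three matrices.  So the sign conditions say that \<open>A\<^sub>c\<close> is Metzler and that
  \<open>J\<^sub>c\<close> and the output matrices are nonnegative (the closed loop is a positive system), and the
  vector inequalities become
  \<open>A\<^sub>c \<xi> + E\<^sub>c \<one> \<le> 0\<close>, \<open>J\<^sub>c \<xi> + E\<^sub>d \<one> \<le> \<xi> - \<epsilon> \<one>\<close> and two bounds \<open>C \<xi> + F \<one> \<le> \<gamma> \<one>\<close> on outputs.

  The proof follows the box \<open>{x. \<bar>x\<bar> \<le> p}\<close>.  A jump with a nonnegative matrix maps the box with corner
  \<open>p\<close> into the box with corner \<open>J\<^sub>c p + E\<^sub>d \<one>\<close>.  A flow with a Metzler matrix cannot leave the box if
  \<open>A\<^sub>c p + E\<^sub>c \<one> \<le> 0\<close>: on the face \<open>x\<^sub>i = p\<^sub>i\<close> the off-diagonal terms are largest at the corner, where the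
  velocity is not positive.  Trajectories are only given by an integral equation with \<open>L\<^sub>\<infinity>\<close> input,
  so lemma \<open>metzler_comparison\<close> replaces this pointwise argument by a first-contact
  argument on integrals.  Lemma \<open>closed_loop_stays_in_boxes\<close> combines flows and jumps.

  For the gain, \<open>\<bar>x\<bar> \<le> \<xi>\<close> holds for ever when \<open>x(0) = 0\<close> and the inputs are bounded by 1, and the output
  inequalities bound the outputs on this box by \<open>\<gamma>\<close>.  For stability the inputs vanish, so every
  multiple of \<open>\<xi>\<close> is a corner that flows preserve, and each jump shrinks the box by a fixed
  factor \<open>\<rho> < 1\<close>.  Flows need not contract at all; convergence to 0 comes from there being infinitely
  many jumps.
\<close>

section \<open>Matrices acting on boxes\<close>

definition metzler :: "real ^ 'n ^ 'n \<Rightarrow> bool" where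
  "metzler M \<longleftrightarrow> (\<forall>i j. i \<noteq> j \<longrightarrow> 0 \<le> M $ i $ j)"

lemma nonneg_matrix_abs_bound:
  fixes M :: "real ^ 'n ^ 'm"
  assumes "0 \<le> M" and "\<bar>v\<bar> \<le> p"
  shows "\<bar>M *v v\<bar> \<le> M *v p"
proof -
  have M: "0 \<le> M $ i $ j" and v: "\<bar>v $ j\<bar> \<le> p $ j" for i j
    using assms by (auto simp: less_eq_vec_def abs_vec_def)
  have "\<bar>\<Sum>j\<in>UNIV. M $ i $ j * v $ j\<bar> \<le> (\<Sum>j\<in>UNIV. M $ i $ j * p $ j)" for i
    by (rule order_trans[OF sum_abs]) (auto intro!: sum_mono mult_left_mono simp: abs_mult M v)
  then show ?thesis
    by (simp add: less_eq_vec_def abs_vec_def matrix_vector_mult_def)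
qed

lemma affine_abs_bound:
  fixes M :: "real ^ 'n ^ 'm" and E :: "real ^ 'k ^ 'm"
  assumes "0 \<le> M" "0 \<le> E" "\<bar>v\<bar> \<le> p" "\<bar>w\<bar> \<le> e" "M *v p + E *v e \<le> q"
  shows "\<bar>M *v v + E *v w\<bar> \<le> q"
proof -
  have "\<bar>M *v v + E *v w\<bar> \<le> \<bar>M *v v\<bar> + \<bar>E *v w\<bar>"
    by (auto simp: less_eq_vec_def abs_vec_def)
  also have "\<dots> \<le> M *v p + E *v e"
    using assms by (intro add_mono nonneg_matrix_abs_bound)
  finally show ?thesis using assms(5) by order
qed

section \<open>Comparison for flows\<close>

lemma integral_form_continuous:
  fixes x :: "real \<Rightarrow> 'a::banach"
  assumes int: "\<And>d. a \<le> d \<Longrightarrow> d \<le> b \<Longrightarrow> (f has_integral (x d - x a)) {a..d}" and "a \<le> b"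
  shows "continuous_on {a..b} x"
proof (rule continuous_on_eq)
  show "continuous_on {a..b} (\<lambda>s. x a + integral {a..s} f)"
    using int[of b] \<open>a \<le> b\<close>
    by (intro continuous_intros indefinite_integral_continuous_1) auto
  show "x a + integral {a..s} f = x s" if "s \<in> {a..b}" for s
    using integral_unique[OF int[of s]] that by simp
qed

text \<open>
  Solutions of \<open>v' = M v + h\<close> with \<open>h \<le> 0\<close> that start below \<open>\<delta>\<close> stay below the barrier
  \<open>\<phi> s = \<delta> exp (L (s - a))\<close>.  At the first contact time \<open>\<tau>\<close>, say in coordinate \<open>j\<close>, all coordinates have
  been below \<open>\<phi>\<close>, and \<open>v\<^sub>j\<close> has been positive on some \<open>[r, \<tau>]\<close>.  There
  \<open>M\<^sub>j\<^sub>k v\<^sub>k \<le> \<bar>M\<^sub>j\<^sub>k\<bar> \<phi>\<close>: for \<open>k \<noteq> j\<close> by the sign of \<open>M\<^sub>j\<^sub>k\<close>, for \<open>k = j\<close> because \<open>0 < v\<^sub>j < \<phi>\<close>.  Integration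
  shows that \<open>v\<^sub>j\<close> grew on \<open>[r, \<tau>]\<close> by at most \<open>\<integral> L \<phi> = \<phi> \<tau> - \<phi> r\<close>, so it could not have caught up with
  \<open>\<phi>\<close> after being below it at \<open>r\<close>.
\<close>

lemma metzler_comparison:
  fixes M :: "real ^ 'n ^ 'n" and v h :: "real \<Rightarrow> real ^ 'n"
  assumes M: "metzler M" and L: "\<And>i. (\<Sum>j\<in>UNIV. \<bar>M $ i $ j\<bar>) \<le> L"
    and int: "\<And>c d. a \<le> c \<Longrightarrow> c \<le> d \<Longrightarrow> d \<le> b \<Longrightarrow>
                ((\<lambda>s. M *v v s + h s) has_integral (v d - v c)) {c..d}"
    and N: "negligible N" and h: "\<And>s. s \<in> {a..b} - N \<Longrightarrow> h s \<le> 0"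
    and init: "\<And>i. v a $ i < \<delta>" and "0 < \<delta>" and "a \<le> b"
  shows "v b $ i < \<delta> * exp (L * (b - a))"
proof (rule ccontr)
  define \<phi> where "\<phi> s = \<delta> * exp (L * (s - a))" for s
  assume "\<not> ?thesis"
  then have viol: "\<phi> b \<le> v b $ i" by (simp add: \<phi>_def)
  have \<phi>_pos: "0 < \<phi> s" for s using \<open>0 < \<delta>\<close> by (simp add: \<phi>_def)
  have cont_v: "continuous_on {a..b} v"
    by (rule integral_form_continuous[OF int]) (use \<open>a \<le> b\<close> in auto)
  have cont_\<phi>: "continuous_on A \<phi>" for A
    unfolding \<phi>_def by (intro continuous_intros)
  define T where "T = {s \<in> {a..b}. \<exists>j. \<phi> s \<le> v s $ j}"
  have "T = (\<Union>j. {s \<in> {a..b}. \<phi> s \<le> v s $ j})" by (auto simp: T_def)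
  moreover have "closed {s \<in> {a..b}. \<phi> s \<le> v s $ j}" for j
    by (intro continuous_on_closed_Collect_le cont_\<phi> continuous_intros cont_v)
  ultimately have "closed T" by auto
  moreover have "T \<subseteq> {a..b}" by (auto simp: T_def)
  ultimately have "compact T"
    by (metis closed_Int_compact compact_Icc inf.absorb_iff1)
  moreover have "b \<in> T" using viol \<open>a \<le> b\<close> by (auto simp: T_def)
  ultimately obtain \<tau> where \<tau>: "\<tau> \<in> T" "\<And>s. s \<in> T \<Longrightarrow> \<tau> \<le> s"
    using compact_attains_inf[of T] by auto
  then obtain j where \<tau>_ab: "a \<le> \<tau>" "\<tau> \<le> b" and j: "\<phi> \<tau> \<le> v \<tau> $ j"
    by (auto simp: T_def)
  have below: "v s $ k < \<phi> s" if "a \<le> s" "s < \<tau>" for s k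
  proof -
    have "s \<notin> T" using \<tau>(2)[of s] that by auto
    then show ?thesis using that \<tau>_ab by (auto simp: T_def not_le)
  qed
  have "a \<noteq> \<tau>" using init[of j] j by (auto simp: \<phi>_def)
  then have "a < \<tau>" using \<tau>_ab by simp
  obtain r where r: "a \<le> r" "r < \<tau>" and pos: "\<And>s. r \<le> s \<Longrightarrow> s \<le> \<tau> \<Longrightarrow> 0 < v s $ j"
  proof -
    have "continuous_on {a..\<tau>} (\<lambda>s. v s $ j)"
      using cont_v \<tau>_ab by (intro continuous_intros) (auto elim: continuous_on_subset)
    then have "((\<lambda>s. v s $ j) \<longlongrightarrow> v \<tau> $ j) (at_left \<tau>)"
      using \<open>a < \<tau>\<close> by (auto dest: continuous_on_Icc_at_leftD)
    moreover have vpos: "0 < v \<tau> $ j" using j \<phi>_pos[of \<tau>] by linarith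
    ultimately have "eventually (\<lambda>s. 0 < v s $ j) (at_left \<tau>)"
      by (rule order_tendstoD)
    then obtain r where "r < \<tau>" "\<And>s. r < s \<Longrightarrow> s < \<tau> \<Longrightarrow> 0 < v s $ j"
      by (auto simp: eventually_at_left_field)
    then have "0 < v s $ j" if "max a ((r + \<tau>) / 2) \<le> s" "s \<le> \<tau>" for s
      using that vpos by (cases "s = \<tau>") (auto simp: field_simps)
    then show thesis
      using that[of "max a ((r + \<tau>) / 2)"] \<open>a < \<tau>\<close> \<open>r < \<tau>\<close> by auto
  qed
  have "v \<tau> $ j - v r $ j \<le> \<phi> \<tau> - \<phi> r"
  proof (rule has_integral_le)
    define g where "g s = (M *v v s + h s) $ j" for s
    \<comment> \<open>The bound on the integrand may fail on \<open>N\<close> and at \<open>\<tau>\<close>; changing it there does not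
      change the integral.\<close>
    have "(g has_integral (v \<tau> $ j - v r $ j)) {r..\<tau>}"
      using has_integral_linear[OF int[of r \<tau>] bounded_linear_vec_nth[of j]] r \<tau>_ab
      by (simp add: g_def[abs_def] o_def)
    then show "((\<lambda>s. if s \<in> insert \<tau> N then L * \<phi> s else g s) has_integral (v \<tau> $ j - v r $ j)) {r..\<tau>}"
      by (rule has_integral_spike[of "insert \<tau> N", rotated 2]) (use N in auto)
    have "(\<phi> has_vector_derivative L * \<phi> s) (at s within {r..\<tau>})" for s
      unfolding \<phi>_def has_real_derivative_iff_has_vector_derivative[symmetric]
      by (auto intro!: derivative_eq_intros)
    then show "((\<lambda>s. L * \<phi> s) has_integral (\<phi> \<tau> - \<phi> r)) {r..\<tau>}"
      using r by (intro fundamental_theorem_of_calculus) auto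
    fix s assume s: "s \<in> {r..\<tau>}"
    show "(if s \<in> insert \<tau> N then L * \<phi> s else g s) \<le> L * \<phi> s"
    proof (cases "s \<in> insert \<tau> N")
      case False
      then have "s < \<tau>" "a \<le> s" using s r by auto
      have "M $ j $ k * v s $ k \<le> \<bar>M $ j $ k\<bar> * \<phi> s" for k
      proof (cases "k = j")
        case True
        have "M $ j $ j * v s $ j \<le> \<bar>M $ j $ j\<bar> * v s $ j"
          using pos[of s] s by (intro mult_right_mono) auto
        also have "\<dots> \<le> \<bar>M $ j $ j\<bar> * \<phi> s"
          using below[OF \<open>a \<le> s\<close> \<open>s < \<tau>\<close>, of j] by (intro mult_left_mono) auto
        finally show ?thesis using True by simp
      next
        case False
        then have "0 \<le> M $ j $ k" using M by (auto simp: metzler_def)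
        then show ?thesis
          using below[OF \<open>a \<le> s\<close> \<open>s < \<tau>\<close>, of k] by (auto intro!: mult_left_mono)
      qed
      then have "(M *v v s) $ j \<le> (\<Sum>k\<in>UNIV. \<bar>M $ j $ k\<bar> * \<phi> s)"
        by (auto simp: matrix_vector_mult_def intro!: sum_mono)
      also have "\<dots> \<le> L * \<phi> s"
        using L[of j] \<phi>_pos[of s] by (simp add: sum_distrib_right[symmetric])
      finally show ?thesis
        using h[of s] False \<tau>_ab r s by (auto simp: g_def less_eq_vec_def intro: add_nonpos_nonpos dest!: spec[of _ j])
    qed simp
  qed
  with j below[OF r, of j] show False by linarith
qed

text \<open>
  Apply the comparison lemma to \<open>x - q\<close>, whose forcing term \<open>g + M q\<close> is not positive.  The value at
  \<open>t0\<close> is only a right limit \<open>x0 \<le> q\<close>, so the comparison starts slightly later, where \<open>x < q + \<delta>\<close>, and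
  \<open>\<delta>\<close> tends to 0.
\<close>

lemma flow_preserves_upper_bound:
  fixes M :: "real ^ 'n ^ 'n" and x g :: "real \<Rightarrow> real ^ 'n"
  assumes M: "metzler M"
    and int: "\<And>c d. t0 < c \<Longrightarrow> c \<le> d \<Longrightarrow> d \<le> t1 \<Longrightarrow>
                ((\<lambda>s. M *v x s + g s) has_integral (x d - x c)) {c..d}"
    and lim: "(x \<longlongrightarrow> x0) (at_right t0)" and "x0 \<le> q"
    and N: "negligible N" and g: "\<And>s. s \<in> {t0<..t1} - N \<Longrightarrow> g s \<le> e"
    and eq: "M *v q + e \<le> 0" and b: "t0 < b" "b \<le> t1"
  shows "x b \<le> q"
proof -
  define L where "L = (\<Sum>i\<in>UNIV. \<Sum>j\<in>UNIV. \<bar>M $ i $ j\<bar>)"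
  have L: "(\<Sum>j\<in>UNIV. \<bar>M $ i $ j\<bar>) \<le> L" for i
    unfolding L_def by (rule member_le_sum) (auto intro: sum_nonneg)
  have "0 \<le> L" unfolding L_def by (intro sum_nonneg) auto
  have "x b $ i \<le> q $ i" for i
  proof (rule field_le_epsilon)
    fix \<eta> :: real assume "0 < \<eta>"
    \<comment> \<open>The barrier starting at \<open>\<delta>\<close> has grown to at most \<open>\<eta>\<close> at time \<open>b\<close>.\<close>
    define \<delta> where "\<delta> = \<eta> / exp (L * (b - t0))"
    have "0 < \<delta>" using \<open>0 < \<eta>\<close> by (simp add: \<delta>_def)
    have "eventually (\<lambda>s. \<forall>i\<in>UNIV. x s $ i < q $ i + \<delta>) (at_right t0)"
    proof (intro eventually_ball_finite ballI)
      fix i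
      have "x0 $ i < q $ i + \<delta>"
        using \<open>x0 \<le> q\<close> \<open>0 < \<delta>\<close> by (auto simp: less_eq_vec_def intro: le_less_trans)
      then show "eventually (\<lambda>s. x s $ i < q $ i + \<delta>) (at_right t0)"
        using tendsto_vec_nth[OF lim, of i] by (auto dest: order_tendstoD)
    qed simp
    moreover have "eventually (\<lambda>s. t0 < s \<and> s < b) (at_right t0)"
      using b by (auto simp: eventually_at_right_field)
    ultimately have "eventually (\<lambda>s. (\<forall>i. x s $ i < q $ i + \<delta>) \<and> t0 < s \<and> s < b) (at_right t0)"
      by (rule eventually_elim2) auto
    then obtain a where a: "\<And>i. x a $ i < q $ i + \<delta>" "t0 < a" "a < b"
      using eventually_happens trivial_limit_at_right_real by blast
    have "(x b - q) $ i < \<delta> * exp (L * (b - a))"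
    proof (rule metzler_comparison[where v = "\<lambda>s. x s - q" and h = "\<lambda>s. g s + M *v q", OF M L _ N])
      show "((\<lambda>s. M *v (x s - q) + (g s + M *v q)) has_integral ((x d - q) - (x c - q))) {c..d}"
        if "a \<le> c" "c \<le> d" "d \<le> b" for c d
        using int[of c d] that a b by (simp add: matrix_vector_mult_diff_distrib)
      show "g s + M *v q \<le> 0" if "s \<in> {a..b} - N" for s
      proof -
        have "g s \<le> e" using that a b by (intro g) auto
        then have "g s + M *v q \<le> M *v q + e" by (simp add: add.commute)
        then show ?thesis using eq by order
      qed
    qed (use a \<open>0 < \<delta>\<close> in \<open>auto simp: algebra_simps\<close>)
    also have "\<dots> \<le> \<delta> * exp (L * (b - t0))"
      using \<open>0 < \<delta>\<close> \<open>0 \<le> L\<close> a by (simp add: mult_left_mono)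
    also have "\<dots> = \<eta>" by (simp add: \<delta>_def)
    finally show "x b $ i \<le> q $ i + \<eta>" by simp
  qed
  then show ?thesis by (simp add: less_eq_vec_def)
qed

text \<open>The equation is linear, so \<open>- x\<close> solves it with forcing \<open>- g\<close>, and the lower
  bound on \<open>x\<close> is an upper bound on \<open>- x\<close>.\<close>

lemma flow_preserves_box:
  fixes M :: "real ^ 'n ^ 'n" and x g :: "real \<Rightarrow> real ^ 'n"
  assumes M: "metzler M"
    and int: "\<And>c d. t0 < c \<Longrightarrow> c \<le> d \<Longrightarrow> d \<le> t1 \<Longrightarrow>
                ((\<lambda>s. M *v x s + g s) has_integral (x d - x c)) {c..d}"
    and lim: "(x \<longlongrightarrow> x0) (at_right t0)" and x0: "\<bar>x0\<bar> \<le> q"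
    and N: "negligible N" and g: "\<And>s. s \<in> {t0<..t1} - N \<Longrightarrow> \<bar>g s\<bar> \<le> e"
    and eq: "M *v q + e \<le> 0" and b: "t0 < b" "b \<le> t1"
  shows "\<bar>x b\<bar> \<le> q"
proof -
  have abs_iff: "\<bar>y\<bar> \<le> z \<longleftrightarrow> y \<le> z \<and> - y \<le> z" for y z :: "real ^ 'n"
    by (auto simp: less_eq_vec_def abs_vec_def abs_le_iff)
  have "x b \<le> q"
    by (rule flow_preserves_upper_bound[OF M int lim _ N _ eq b]) (use x0 g in \<open>auto simp: abs_iff\<close>)
  moreover have "- x b \<le> q"
  proof (rule flow_preserves_upper_bound[OF M _ tendsto_minus[OF lim] _ N _ eq b, where g = "\<lambda>s. - g s"])
    show "((\<lambda>s. M *v - x s + - g s) has_integral (- x d - - x c)) {c..d}"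
      if "t0 < c" "c \<le> d" "d \<le> t1" for c d
    proof -
      have "M *v - y = - (M *v y)" for y
        using matrix_vector_mult_diff_distrib[of M 0 y] by simp
      then show ?thesis using has_integral_neg[OF int[OF that]] by (simp add: algebra_simps)
    qed
  qed (use x0 g in \<open>auto simp: abs_iff\<close>)
  ultimately show ?thesis by (simp add: abs_iff)
qed

section \<open>Closed-loop trajectories\<close>

lemma impulse_times_less:
  assumes "impulse_times t" "j < k"
  shows "t j < t k"
proof (rule lift_Suc_mono_less[OF _ \<open>j < k\<close>])
  show "t n < t (Suc n)" for n using assms(1) by (simp add: impulse_times_def)
qed

lemma impulse_times_nonneg:
  assumes "impulse_times t"
  shows "0 \<le> t k"
  using assms impulse_times_less[OF assms, of 0 k] by (cases k) (auto simp: impulse_times_def)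

text \<open>The left-open pieces \<open>(t\<^sub>k, t\<^sub>k\<^sub>+\<^sub>1]\<close> exhaust the positive half-line because the impulse
  times diverge.\<close>

lemma impulse_interval:
  assumes t: "impulse_times t" and "0 < s"
  obtains k where "t k < s" "s \<le> t (Suc k)"
proof -
  have "\<exists>k. s \<le> t k"
    using t unfolding impulse_times_def filterlim_at_top eventually_sequentially by blast
  then have k: "s \<le> t (LEAST k. s \<le> t k)" by (rule LeastI_ex)
  then obtain m where m: "(LEAST k. s \<le> t k) = Suc m"
    using t \<open>0 < s\<close> by (cases "LEAST k. s \<le> t k") (auto simp: impulse_times_def)
  then have "\<not> s \<le> t m" using not_less_Least[of m "\<lambda>k. s \<le> t k"] by simp
  with k m that[of m] show thesis by simp
qed

abbreviation closed_loop_flow_matrix where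
  "closed_loop_flow_matrix S Kc \<equiv> sys_A S + sys_Bc S ** Kc"

abbreviation closed_loop_jump_matrix where
  "closed_loop_jump_matrix S Kd \<equiv> sys_J S + sys_Bd S ** Kd"

lemma closed_loop_flow:
  assumes "closed_loop_trajectory S Kc Kd t wc wd x" "t k < a" "a \<le> b" "b \<le> t (Suc k)"
  shows "((\<lambda>s. closed_loop_flow_matrix S Kc *v x s + sys_Ec S *v wc s) has_integral (x b - x a)) {a..b}"
proof -
  have "((\<lambda>s. sys_A S *v x s + sys_Bc S *v feedback_c Kc x s + sys_Ec S *v wc s)
          has_integral (x b - x a)) {a..b}"
    using assms unfolding closed_loop_trajectory_def trajectory_def by blast
  then show ?thesis
    by (simp add: feedback_c_def matrix_vector_mult_add_rdistrib matrix_vector_mul_assoc)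
qed

lemma closed_loop_start:
  assumes "closed_loop_trajectory S Kc Kd t wc wd x"
  shows "(x \<longlongrightarrow> x 0) (at_right 0)"
  using assms unfolding closed_loop_trajectory_def trajectory_def by blast

lemma closed_loop_jump:
  assumes "closed_loop_trajectory S Kc Kd t wc wd x" "1 \<le> k"
  shows "(x \<longlongrightarrow> closed_loop_jump_matrix S Kd *v x (t k) + sys_Ed S *v wd k) (at_right (t k))"
proof -
  have "(x \<longlongrightarrow> sys_J S *v x (t k) + sys_Bd S *v feedback_d Kd t x k + sys_Ed S *v wd k) (at_right (t k))"
    using assms unfolding closed_loop_trajectory_def trajectory_def by blast
  then show ?thesis
    by (simp add: feedback_d_def matrix_vector_mult_add_rdistrib matrix_vector_mul_assoc)
qed

text \<open>
  The corner \<open>p k\<close> may depend on the interval.  A constant sequence gives invariance of one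
  box under disturbances; a geometric one gives exponential decay in the number of jumps.
\<close>

lemma closed_loop_stays_in_boxes:
  assumes t: "impulse_times t" and traj: "closed_loop_trajectory S Kc Kd t wc wd x"
    and M: "metzler (closed_loop_flow_matrix S Kc)" and J: "0 \<le> closed_loop_jump_matrix S Kd"
    and E: "0 \<le> sys_Ec S" "0 \<le> sys_Ed S"
    and N: "negligible N" and wc: "\<And>s. s \<in> {0..} - N \<Longrightarrow> \<bar>wc s\<bar> \<le> ec"
    and wd: "\<And>k. 1 \<le> k \<Longrightarrow> \<bar>wd k\<bar> \<le> ed"
    and flow: "\<And>k. closed_loop_flow_matrix S Kc *v p k + sys_Ec S *v ec \<le> 0"
    and jump: "\<And>k. closed_loop_jump_matrix S Kd *v p k + sys_Ed S *v ed \<le> p (Suc k)"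
    and x0: "\<bar>x 0\<bar> \<le> p 0"
    and s: "t k < s" "s \<le> t (Suc k)"
  shows "\<bar>x s\<bar> \<le> p k"
proof -
  have t0: "t 0 = 0" using t by (simp add: impulse_times_def)
  note tpos = impulse_times_nonneg[OF t]
  have step: "\<bar>x s\<bar> \<le> p k"
    if "(x \<longlongrightarrow> x0) (at_right (t k))" "\<bar>x0\<bar> \<le> p k" "t k < s" "s \<le> t (Suc k)" for x0 s k
  proof (rule flow_preserves_box[OF M closed_loop_flow[OF traj] that(1,2) N _ flow that(3,4)])
    fix s assume "s \<in> {t k<..t (Suc k)} - N"
    then have "s \<in> {0..} - N" using tpos[of k] by auto
    then show "\<bar>sys_Ec S *v wc s\<bar> \<le> sys_Ec S *v ec"
      by (intro nonneg_matrix_abs_bound E wc)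
  qed
  show ?thesis
    using s
  proof (induction k arbitrary: s)
    case 0
    then show ?case
      using step[of "x 0" 0 s] closed_loop_start[OF traj] t0 x0 by simp
  next
    case (Suc k)
    have "\<bar>x (t (Suc k))\<bar> \<le> p k"
      using Suc.IH[of "t (Suc k)"] impulse_times_less[OF t, of k "Suc k"] by simp
    then have "\<bar>closed_loop_jump_matrix S Kd *v x (t (Suc k)) + sys_Ed S *v wd (Suc k)\<bar> \<le> p (Suc k)"
      by (rule affine_abs_bound[OF J E(2) _ wd jump]) simp
    then show ?case
      using step[OF closed_loop_jump[OF traj, of "Suc k"], of s] Suc.prems by simp
  qed
qed

text \<open>
  The essential supremum of a non-measurable function is \<open>\<infinity>\<close> by definition, so a bound on the output norm
  needs measurability.  It holds because a trajectory is continuous on each of the countably many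
  pieces \<open>(t\<^sub>k, t\<^sub>k\<^sub>+\<^sub>1]\<close>.
\<close>

lemma closed_loop_trajectory_measurable:
  assumes t: "impulse_times t" and traj: "closed_loop_trajectory S Kc Kd t wc wd x"
  shows "x \<in> borel_measurable (lebesgue_on {0..})"
proof (rule measurable_piecewise_restrict)
  let ?C = "insert {0} (range (\<lambda>k. {t k<..t (Suc k)}))"
  show "countable ?C" by simp
  have "s \<in> \<Union>?C" if "0 \<le> s" for s
  proof (cases "s = 0")
    case False
    then have "0 < s" using that by simp
    then obtain k where "t k < s" "s \<le> t (Suc k)" by (rule impulse_interval[OF t])
    then show ?thesis by auto
  qed simp
  moreover have "space (lebesgue_on {0..}) = {0::real..}" by simp
  ultimately show "space (lebesgue_on {0..}) \<subseteq> \<Union>?C" by (metis atLeast_iff subsetI)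
  have sub: "\<Omega> \<subseteq> {0..}" "\<Omega> \<in> sets lebesgue" if "\<Omega> \<in> ?C" for \<Omega>
  proof -
    have "{t k<..t (Suc k)} \<subseteq> {0..}" for k using impulse_times_nonneg[OF t, of k] by auto
    then show "\<Omega> \<subseteq> {0..}" "\<Omega> \<in> sets lebesgue" using that by auto
  qed
  show "\<Omega> \<inter> space (lebesgue_on {0..}) \<in> sets (lebesgue_on {0..})" if "\<Omega> \<in> ?C" for \<Omega>
    using sub[OF that] by (auto simp: sets_restrict_space)
  have cont: "continuous_on {t k<..t (Suc k)} x" for k
    unfolding continuous_on_eq_continuous_within
  proof
    fix s assume s: "s \<in> {t k<..t (Suc k)}"
    define a where "a = (t k + s) / 2"
    have a: "t k < a" "a < s" using s by (auto simp: a_def)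
    have "continuous_on {a..t (Suc k)} x"
      using a s by (intro integral_form_continuous[OF closed_loop_flow[OF traj, of k]]) auto
    then have "continuous (at s within {a..t (Suc k)}) x"
      using s a by (auto simp: continuous_on_eq_continuous_within)
    moreover have "at s within {a..t (Suc k)} = at s within {t k<..t (Suc k)}"
      using a by (intro at_within_nhd[where S = "{a<..}"]) auto
    ultimately show "continuous (at s within {t k<..t (Suc k)}) x" by simp
  qed
  show "x \<in> borel_measurable (restrict_space (lebesgue_on {0..}) \<Omega>)" if "\<Omega> \<in> ?C" for \<Omega>
  proof -
    have "x \<in> borel_measurable (lebesgue_on \<Omega>)"
      using that cont sub(2)[OF that] by (intro continuous_imp_measurable_on_sets_lebesgue) auto
    moreover have "restrict_space (lebesgue_on {0..}) \<Omega> = lebesgue_on \<Omega>"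
      using sub[OF that] by (subst restrict_restrict_space) (auto simp: Int_absorb1)
    ultimately show ?thesis by simp
  qed
qed

section \<open>Signal norms as box bounds\<close>

lemma borel_measurable_matrix_vector_mult:
  fixes A :: "real ^ 'n ^ 'm"
  assumes "f \<in> borel_measurable M"
  shows "(\<lambda>s. A *v f s) \<in> borel_measurable M"
  using borel_measurable_continuous_onI[OF matrix_vector_mult_linear_continuous_on[of UNIV A]] assms
  by (rule measurable_compose[rotated])

lemma infnorm_le_iff_abs:
  fixes v :: "real ^ 'n"
  shows "infnorm v \<le> c \<longleftrightarrow> \<bar>v\<bar> \<le> c *\<^sub>R 1"
proof -
  have "infnorm v \<le> c \<longleftrightarrow> (\<forall>b\<in>Basis. \<bar>v \<bullet> b\<bar> \<le> c)"
    unfolding infnorm_Max by (subst Max_le_iff) auto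
  also have "\<dots> \<longleftrightarrow> \<bar>v\<bar> \<le> c *\<^sub>R 1"
    by (auto simp: less_eq_vec_def abs_vec_def Basis_vec_def inner_axis)
  finally show ?thesis .
qed

lemma Linf_norm_le_imp_bounded:
  assumes "Linf_norm w \<le> ereal c"
  obtains N where "negligible N" "\<And>s. s \<in> {0..} - N \<Longrightarrow> \<bar>w s\<bar> \<le> c *\<^sub>R 1"
proof -
  have "AE s in lebesgue_on {0..}. infnorm (w s) \<le> c"
    using esssup_AE[where M = "lebesgue_on {0..}" and f = "\<lambda>s. ereal (infnorm (w s))"]
  proof eventually_elim
    case (elim s)
    then have "ereal (infnorm (w s)) \<le> ereal c"
      using assms unfolding Linf_norm_def by (rule order_trans)
    then show ?case by simp
  qed
  then have "AE s in lebesgue. s \<in> {0..} \<longrightarrow> infnorm (w s) \<le> c"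
    by (simp add: AE_restrict_space_iff)
  then obtain N where "N \<in> null_sets lebesgue" "{s. \<not> (s \<in> {0..} \<longrightarrow> infnorm (w s) \<le> c)} \<subseteq> N"
    by (auto simp: eventually_ae_filter)
  then show thesis
    using that[of N] by (auto simp: negligible_iff_null_sets infnorm_le_iff_abs)
qed

lemma linf_norm_le_iff_bounded:
  "linf_norm w \<le> ereal c \<longleftrightarrow> (\<forall>k\<ge>1. \<bar>w k\<bar> \<le> c *\<^sub>R 1)"
  by (auto simp: linf_norm_def SUP_le_iff infnorm_le_iff_abs)

lemma Linf_norm_leI:
  assumes "w \<in> borel_measurable (lebesgue_on {0..})" "negligible N"
    and "\<And>s. s \<in> {0..} - N \<Longrightarrow> \<bar>w s\<bar> \<le> c *\<^sub>R 1"
  shows "Linf_norm w \<le> ereal c"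
  unfolding Linf_norm_def
proof (rule esssup_I)
  have "(infnorm :: real ^ 'a \<Rightarrow> real) \<in> borel_measurable borel"
    by (intro borel_measurable_continuous_onI continuous_on_infnorm continuous_on_id)
  then show "(\<lambda>s. ereal (infnorm (w s))) \<in> borel_measurable (lebesgue_on {0..})"
    using assms(1) by measurable
  show "AE s in lebesgue_on {0..}. ereal (infnorm (w s)) \<le> ereal c"
  proof -
    have "AE s in lebesgue. s \<notin> N"
      using assms(2) by (intro AE_not_in) (simp add: negligible_iff_null_sets)
    then have "AE s in lebesgue. s \<in> {0..} \<longrightarrow> ereal (infnorm (w s)) \<le> ereal c"
      by eventually_elim (use assms(3) in \<open>auto simp: infnorm_le_iff_abs\<close>)
    then show ?thesis by (simp add: AE_restrict_space_iff)
  qed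
qed

section \<open>Scaling by a diagonal matrix\<close>

lemma diagonal_posdef_entry_pos:
  assumes "diagonal_posdef X"
  shows "0 < X $ i $ i"
proof -
  have "0 < axis i 1 \<bullet> (X *v axis i 1)"
    using assms by (auto simp: diagonal_posdef_def axis_eq_0_iff)
  then show ?thesis
    by (simp add: inner_axis' matrix_vector_mult_basis column_def)
qed

lemma diagonal_posdef_inverse:
  assumes "diagonal_posdef X"
  shows "matrix_inv X ** X = mat 1"
proof -
  have "X *v v = 0 \<Longrightarrow> v = 0" for v
    using assms by (force simp: diagonal_posdef_def)
  then have "\<exists>B. B ** X = mat 1" by (simp add: matrix_left_invertible_ker)
  then have "\<exists>B. X ** B = mat 1 \<and> B ** X = mat 1" by (metis matrix_left_right_inverse)
  then show ?thesis unfolding matrix_inv_def by (rule someI2_ex) simp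
qed

lemma feedback_times_scaling:
  fixes A :: "real ^ 'n ^ 'q" and B :: "real ^ 'm ^ 'q"
  assumes "diagonal_posdef X"
  shows "(A + B ** (U ** matrix_inv X)) ** X = A ** X + B ** U"
proof -
  have "B ** (U ** matrix_inv X) ** X = B ** (U ** (matrix_inv X ** X))"
    by (simp add: matrix_mul_assoc)
  moreover have "(A + P) ** X = A ** X + P ** X" for P
    by (vector matrix_matrix_mult_def sum.distrib[symmetric] field_simps)
  ultimately show ?thesis
    by (simp add: diagonal_posdef_inverse[OF assms])
qed

lemma times_diagonal_entry:
  fixes M :: "real ^ 'n ^ 'm"
  assumes "diagonal_posdef X"
  shows "(M ** X) $ i $ j = M $ i $ j * X $ j $ j"
proof -
  have "(M ** X) $ i $ j = (\<Sum>k\<in>UNIV. if k = j then M $ i $ j * X $ j $ j else 0)"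
    unfolding matrix_matrix_mult_def vec_lambda_beta using assms
    by (intro sum.cong) (auto simp: diagonal_posdef_def)
  then show ?thesis by simp
qed

lemma nonneg_of_times_diagonal:
  fixes M :: "real ^ 'n ^ 'm"
  assumes X: "diagonal_posdef X" and "0 \<le> M ** X"
  shows "0 \<le> M"
proof -
  have "0 \<le> M $ i $ j" for i j
  proof -
    have "0 \<le> M $ i $ j * X $ j $ j"
      using assms(2) by (simp add: less_eq_vec_def times_diagonal_entry[OF X])
    then show ?thesis
      using diagonal_posdef_entry_pos[OF X, of j] by (simp add: zero_le_mult_iff)
  qed
  then show ?thesis by (simp add: less_eq_vec_def)
qed

text \<open>The term \<open>\<alpha> I\<close> only affects the diagonal, where a Metzler matrix is unconstrained.\<close>

lemma metzler_of_times_diagonal: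
  fixes M :: "real ^ 'n ^ 'n"
  assumes X: "diagonal_posdef X" and "0 \<le> M ** X + \<alpha> *\<^sub>R mat 1"
  shows "metzler M"
  unfolding metzler_def
proof (intro allI impI)
  fix i j :: 'n assume "i \<noteq> j"
  moreover have "0 \<le> (M ** X + \<alpha> *\<^sub>R mat 1) $ i $ j"
    using assms(2) by (auto simp: less_eq_vec_def)
  ultimately have "0 \<le> M $ i $ j * X $ j $ j"
    by (simp add: times_diagonal_entry[OF X] mat_def)
  then show "0 \<le> M $ i $ j"
    using diagonal_posdef_entry_pos[OF X, of j] by (simp add: zero_le_mult_iff)
qed

section \<open>Stability and gain\<close>

text \<open>
  An initial state lies in the box with corner \<open>c \<xi>\<close> for \<open>c = norm (x 0) / \<epsilon>\<close>, because \<open>\<epsilon> \<le> \<xi>\<^sub>i\<close>.  After \<open>k\<close>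
  jumps the trajectory lies in the box with corner \<open>c \<rho>\<^sup>k \<xi>\<close>, which yields both the Lyapunov estimate
  (\<open>\<rho>\<^sup>k \<le> 1\<close>) and convergence (\<open>k\<close> is unbounded along the time axis).
\<close>

lemma closed_loop_asymptotically_stable_if_jumps_shrink:
  assumes t: "impulse_times t"
    and M: "metzler (closed_loop_flow_matrix S Kc)" and J: "0 \<le> closed_loop_jump_matrix S Kd"
    and E: "0 \<le> sys_Ec S" "0 \<le> sys_Ed S"
    and flow: "closed_loop_flow_matrix S Kc *v \<xi> \<le> 0"
    and jump: "closed_loop_jump_matrix S Kd *v \<xi> \<le> \<xi> - \<epsilon> *\<^sub>R 1"
    and \<epsilon>: "0 < \<epsilon>" "\<And>i. \<epsilon> \<le> \<xi> $ i"
  shows "closed_loop_asymptotically_stable S Kc Kd t"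
proof -
  define m where "m = (\<Sum>i\<in>UNIV. \<xi> $ i)"
  have \<xi>_m: "\<xi> $ i \<le> m" for i
    unfolding m_def using \<epsilon> by (intro member_le_sum) (auto intro: order_trans less_imp_le)
  then have m: "\<epsilon> \<le> m" "0 < m" using \<epsilon> by (meson order_trans, meson less_le_trans order_trans)
  \<comment> \<open>An absolute loss of \<open>\<epsilon>\<close> per jump is a relative loss of at least \<open>\<epsilon> / m\<close> in every coordinate.\<close>
  define \<rho> where "\<rho> = 1 - \<epsilon> / m"
  have \<rho>: "0 \<le> \<rho>" "\<rho> < 1" using m \<open>0 < \<epsilon>\<close> by (auto simp: \<rho>_def)
  have "\<xi> - \<epsilon> *\<^sub>R 1 \<le> \<rho> *\<^sub>R \<xi>"
    using \<xi>_m m \<open>0 < \<epsilon>\<close> by (auto simp: less_eq_vec_def \<rho>_def field_simps)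
  with jump have contraction: "closed_loop_jump_matrix S Kd *v \<xi> \<le> \<rho> *\<^sub>R \<xi>" by order
  have decay: "norm (x s) \<le> norm (x 0) * m / \<epsilon> * \<rho> ^ k"
    if traj: "closed_loop_trajectory S Kc Kd t (\<lambda>_. 0) (\<lambda>_. 0) x"
      and s: "t k < s" "s \<le> t (Suc k)" for x s k
  proof -
    define c where "c = norm (x 0) / \<epsilon>"
    have "0 \<le> c" using \<epsilon> by (simp add: c_def)
    have "\<bar>x s\<bar> \<le> (c * \<rho> ^ k) *\<^sub>R \<xi>"
    proof (rule closed_loop_stays_in_boxes[OF t traj M J E negligible_empty, where ec = 0 and ed = 0, OF _ _ _ _ _ s])
      show "closed_loop_flow_matrix S Kc *v ((c * \<rho> ^ k) *\<^sub>R \<xi>) + sys_Ec S *v 0 \<le> 0" for k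
        using flow \<open>0 \<le> c\<close> \<rho>
        by (auto simp: matrix_vector_mult_scaleR less_eq_vec_def mult_nonneg_nonpos)
      show "closed_loop_jump_matrix S Kd *v ((c * \<rho> ^ k) *\<^sub>R \<xi>) + sys_Ed S *v 0 \<le> (c * \<rho> ^ Suc k) *\<^sub>R \<xi>" for k
        using scaleR_left_mono[OF contraction, of "c * \<rho> ^ k"] \<open>0 \<le> c\<close> \<rho>
        by (simp add: matrix_vector_mult_scaleR mult_ac)
      have "\<bar>x 0 $ i\<bar> \<le> c * \<xi> $ i" for i
      proof -
        have "\<bar>x 0 $ i\<bar> \<le> c * \<epsilon>" using \<epsilon> component_le_norm_cart[of "x 0" i] by (simp add: c_def)
        also have "\<dots> \<le> c * \<xi> $ i" using \<epsilon> \<open>0 \<le> c\<close> by (intro mult_left_mono)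
        finally show ?thesis .
      qed
      then show "\<bar>x 0\<bar> \<le> (c * \<rho> ^ 0) *\<^sub>R \<xi>" by (simp add: less_eq_vec_def abs_vec_def)
    qed simp_all
    then have "\<bar>x s $ i\<bar> \<le> c * \<rho> ^ k * \<xi> $ i" for i by (simp add: less_eq_vec_def abs_vec_def)
    then have "(\<Sum>i\<in>UNIV. \<bar>x s $ i\<bar>) \<le> (\<Sum>i\<in>UNIV. c * \<rho> ^ k * \<xi> $ i)"
      by (rule sum_mono)
    also have "\<dots> = norm (x 0) * m / \<epsilon> * \<rho> ^ k"
      unfolding m_def c_def sum_distrib_left[symmetric] by simp
    finally show ?thesis using norm_le_l1_cart[of "x s"] by linarith
  qed
  have bounded: "norm (x s) \<le> norm (x 0) * m / \<epsilon>"
    if traj: "closed_loop_trajectory S Kc Kd t (\<lambda>_. 0) (\<lambda>_. 0) x" and "0 \<le> s" for x s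
  proof (cases "s = 0")
    case True
    then show ?thesis using m \<epsilon> by (simp add: pos_le_divide_eq mult_left_mono)
  next
    case False
    then have "0 < s" using that by simp
    then obtain k where "t k < s" "s \<le> t (Suc k)" by (rule impulse_interval[OF t])
    then have "norm (x s) \<le> norm (x 0) * m / \<epsilon> * \<rho> ^ k" by (rule decay[OF traj])
    also have "\<dots> \<le> norm (x 0) * m / \<epsilon> * 1"
      using m \<epsilon> \<rho> by (intro mult_left_mono power_le_one) auto
    finally show ?thesis by simp
  qed
  show ?thesis
    unfolding closed_loop_asymptotically_stable_def
  proof (intro conjI allI impI)
    fix e :: real assume "0 < e"
    show "\<exists>d>0. \<forall>x. closed_loop_trajectory S Kc Kd t (\<lambda>_. 0) (\<lambda>_. 0) x \<and> norm (x 0) < d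
            \<longrightarrow> (\<forall>s\<ge>0. norm (x s) < e)"
    proof (intro exI[of _ "e * \<epsilon> / m"] conjI allI impI)
      show "0 < e * \<epsilon> / m" using \<open>0 < e\<close> \<epsilon> m by simp
      fix x and s :: real
      assume x: "closed_loop_trajectory S Kc Kd t (\<lambda>_. 0) (\<lambda>_. 0) x \<and> norm (x 0) < e * \<epsilon> / m"
        and "0 \<le> s"
      have "norm (x s) \<le> norm (x 0) * m / \<epsilon>" using bounded x \<open>0 \<le> s\<close> by blast
      also have "\<dots> < e" using x m \<epsilon> by (simp add: field_simps)
      finally show "norm (x s) < e" .
    qed
  next
    fix x assume traj: "closed_loop_trajectory S Kc Kd t (\<lambda>_. 0) (\<lambda>_. 0) x"
    show "(x \<longlongrightarrow> 0) at_top"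
    proof (rule tendstoI)
      fix e :: real assume "0 < e"
      have "(\<lambda>k. norm (x 0) * m / \<epsilon> * \<rho> ^ k) \<longlonglongrightarrow> norm (x 0) * m / \<epsilon> * 0"
        using \<rho> by (intro tendsto_intros LIMSEQ_realpow_zero)
      then have "eventually (\<lambda>k. norm (x 0) * m / \<epsilon> * \<rho> ^ k < e) sequentially"
        using \<open>0 < e\<close> by (simp add: order_tendstoD)
      then obtain K where K: "norm (x 0) * m / \<epsilon> * \<rho> ^ k < e" if "K \<le> k" for k
        by (auto simp: eventually_sequentially)
      have "dist (x s) 0 < e" if s: "max 0 (t K) < s" for s
      proof -
        have "0 < s" using s by simp
        then obtain k where k: "t k < s" "s \<le> t (Suc k)" by (rule impulse_interval[OF t])
        have "K \<le> k"
        proof (rule ccontr)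
          assume "\<not> K \<le> k"
          then have "t (Suc k) \<le> t K"
            using impulse_times_less[OF t, of "Suc k" K] by (cases "Suc k = K") auto
          with k s show False by simp
        qed
        with decay[OF traj k] K[of k] show ?thesis by simp
      qed
      then show "eventually (\<lambda>s. dist (x s) 0 < e) at_top"
        using eventually_gt_at_top[of "max 0 (t K)"] by (rule eventually_mono[rotated])
    qed
  qed
qed

text \<open>
  The corner \<open>\<xi>\<close> is preserved by flows and jumps against the worst inputs of norm 1, so a trajectory
  from 0 stays in its box.  Each output is then a nonnegative combination of quantities
  bounded by \<open>\<xi>\<close> and \<open>\<one>\<close>.
\<close>

lemma hybrid_gain_le_if_box_invariant:
  fixes S :: "('n::finite, 'mc::finite, 'md::finite, 'pc::finite, 'pd::finite, 'qc::finite, 'qd::finite)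
                impulsive_system"
  assumes M: "metzler (closed_loop_flow_matrix S Kc)" and J: "0 \<le> closed_loop_jump_matrix S Kd"
    and E: "0 \<le> sys_Ec S" "0 \<le> sys_Ed S" and F: "0 \<le> sys_Fc S" "0 \<le> sys_Fd S"
    and C: "0 \<le> sys_Cc S + sys_Dc S ** Kc" "0 \<le> sys_Cd S + sys_Dd S ** Kd"
    and flow: "closed_loop_flow_matrix S Kc *v \<xi> + sys_Ec S *v 1 \<le> 0"
    and jump: "closed_loop_jump_matrix S Kd *v \<xi> + sys_Ed S *v 1 \<le> \<xi>"
    and outc: "(sys_Cc S + sys_Dc S ** Kc) *v \<xi> + sys_Fc S *v 1 \<le> \<gamma> *\<^sub>R 1"
    and outd: "(sys_Cd S + sys_Dd S ** Kd) *v \<xi> + sys_Fd S *v 1 \<le> \<gamma> *\<^sub>R 1"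
    and \<xi>: "0 \<le> \<xi>"
  shows "hybrid_gain S Kc Kd \<le> ereal \<gamma>"
  unfolding hybrid_gain_def
proof (rule Sup_least, clarify)
  fix t wc wd x
  assume t: "impulse_times t" and wc_meas: "wc \<in> borel_measurable (lebesgue_on {0..})"
    and w: "max (Linf_norm wc) (linf_norm wd) = 1"
    and traj: "closed_loop_trajectory S Kc Kd t wc wd x" and x0: "x 0 = 0"
  have "Linf_norm wc \<le> ereal 1" "linf_norm wd \<le> ereal 1"
    unfolding one_ereal_def[symmetric] w[symmetric] by simp_all
  then obtain N where N: "negligible N" and wc: "\<And>s. s \<in> {0..} - N \<Longrightarrow> \<bar>wc s\<bar> \<le> 1"
    and wd: "\<And>k. 1 \<le> k \<Longrightarrow> \<bar>wd k\<bar> \<le> 1"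
    by (auto simp: linf_norm_le_iff_bounded elim!: Linf_norm_le_imp_bounded)
  have box: "\<bar>x s\<bar> \<le> \<xi>" if "0 \<le> s" for s
  proof (cases "s = 0")
    case True
    then show ?thesis using x0 \<xi> by simp
  next
    case False
    then have "0 < s" using that by simp
    then obtain k where k: "t k < s" "s \<le> t (Suc k)" by (rule impulse_interval[OF t])
    show ?thesis
    proof (rule closed_loop_stays_in_boxes
        [where p = "\<lambda>_. \<xi>" and ec = 1 and ed = 1, OF t traj M J E N _ _ _ _ _ k])
      show "\<bar>x 0\<bar> \<le> \<xi>" using x0 \<xi> by simp
    qed (fact wc wd flow jump)+
  qed
  have "Linf_norm (output_c S (feedback_c Kc x) wc x) \<le> ereal \<gamma>"
  proof (rule Linf_norm_leI[OF _ N])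
    have out: "output_c S (feedback_c Kc x) wc x = (\<lambda>s. (sys_Cc S + sys_Dc S ** Kc) *v x s + sys_Fc S *v wc s)"
      by (auto simp: output_c_def feedback_c_def matrix_vector_mult_add_rdistrib matrix_vector_mul_assoc)
    show "output_c S (feedback_c Kc x) wc x \<in> borel_measurable (lebesgue_on {0..})"
      unfolding out
      by (intro borel_measurable_add borel_measurable_matrix_vector_mult wc_meas
          closed_loop_trajectory_measurable[OF t traj])
    show "\<bar>output_c S (feedback_c Kc x) wc x s\<bar> \<le> \<gamma> *\<^sub>R 1" if "s \<in> {0..} - N" for s
      unfolding out using that by (intro affine_abs_bound[OF C(1) F(1) box wc outc]) auto
  qed
  moreover have "linf_norm (output_d S t (feedback_d Kd t x) wd x) \<le> ereal \<gamma>"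
    unfolding linf_norm_le_iff_bounded
  proof (intro allI impI)
    fix k :: nat assume "1 \<le> k"
    note t_nonneg = impulse_times_nonneg[OF t, of k]
    have "output_d S t (feedback_d Kd t x) wd x k = (sys_Cd S + sys_Dd S ** Kd) *v x (t k) + sys_Fd S *v wd k"
      by (simp add: output_d_def feedback_d_def matrix_vector_mult_add_rdistrib matrix_vector_mul_assoc)
    then show "\<bar>output_d S t (feedback_d Kd t x) wd x k\<bar> \<le> \<gamma> *\<^sub>R 1"
      using affine_abs_bound[OF C(2) F(2) box[OF t_nonneg] wd[OF \<open>1 \<le> k\<close>] outd] by simp
  qed
  ultimately show "max (Linf_norm (output_c S (feedback_c Kc x) wc x))
      (linf_norm (output_d S t (feedback_d Kd t x) wd x)) \<le> ereal \<gamma>"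
    by simp
qed

section \<open>The design conditions\<close>

theorem theorem4p1:
  fixes S :: "('n::finite, 'mc::finite, 'md::finite, 'pc::finite, 'pd::finite, 'qc::finite, 'qd::finite)
                impulsive_system"
    and X :: "real ^ 'n ^ 'n" and Uc :: "real ^ 'n ^ 'mc" and Ud :: "real ^ 'n ^ 'md"
    and \<epsilon> \<alpha> \<gamma> :: real
  assumes "sys_Ec S \<ge> 0" and "sys_Fc S \<ge> 0" and "sys_Ed S \<ge> 0" and "sys_Fd S \<ge> 0"
    and "diagonal_posdef X" and "\<epsilon> > 0" and "\<alpha> > 0" and "\<gamma> > 0"
    and "sys_A S ** X + sys_Bc S ** Uc + \<alpha> *\<^sub>R mat 1 \<ge> 0"
    and "sys_J S ** X + sys_Bd S ** Ud \<ge> 0"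
    and "sys_Cc S ** X + sys_Dc S ** Uc \<ge> 0"
    and "sys_Cd S ** X + sys_Dd S ** Ud \<ge> 0"
    and "(sys_A S ** X + sys_Bc S ** Uc) *v 1 + sys_Ec S *v 1 \<le> 0"
    and "(sys_J S ** X + sys_Bd S ** Ud - X + \<epsilon> *\<^sub>R mat 1) *v 1 + sys_Ed S *v 1 \<le> 0"
    and "(sys_Cc S ** X + sys_Dc S ** Uc) *v 1 + sys_Fc S *v 1 - \<gamma> *\<^sub>R 1 \<le> 0"
    and "(sys_Cd S ** X + sys_Dd S ** Ud) *v 1 + sys_Fd S *v 1 - \<gamma> *\<^sub>R 1 \<le> 0"
  shows "(\<forall>t. impulse_times t \<longrightarrow>
            closed_loop_asymptotically_stable S (Uc ** matrix_inv X) (Ud ** matrix_inv X) t) \<and>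
         hybrid_gain S (Uc ** matrix_inv X) (Ud ** matrix_inv X) \<le> ereal \<gamma>"
proof -
  define Kc where "Kc = Uc ** matrix_inv X"
  define Kd where "Kd = Ud ** matrix_inv X"
  define \<xi> where "\<xi> = X *v 1"
  note X = assms(5)
  have scaled: "closed_loop_flow_matrix S Kc ** X = sys_A S ** X + sys_Bc S ** Uc"
    "closed_loop_jump_matrix S Kd ** X = sys_J S ** X + sys_Bd S ** Ud"
    "(sys_Cc S + sys_Dc S ** Kc) ** X = sys_Cc S ** X + sys_Dc S ** Uc"
    "(sys_Cd S + sys_Dd S ** Kd) ** X = sys_Cd S ** X + sys_Dd S ** Ud"
    unfolding Kc_def Kd_def by (simp_all only: feedback_times_scaling[OF X])
  have M: "metzler (closed_loop_flow_matrix S Kc)"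
    using assms(9) by (intro metzler_of_times_diagonal[OF X]) (simp only: scaled)
  have J: "0 \<le> closed_loop_jump_matrix S Kd"
    and C: "0 \<le> sys_Cc S + sys_Dc S ** Kc" "0 \<le> sys_Cd S + sys_Dd S ** Kd"
    using assms(10-12) by - (rule nonneg_of_times_diagonal[OF X], simp only: scaled)+
  have at_\<xi>: "P *v \<xi> = (P ** X) *v 1" for P :: "real ^ 'n ^ 'k"
    by (simp add: \<xi>_def matrix_vector_mul_assoc)
  have flow: "closed_loop_flow_matrix S Kc *v \<xi> + sys_Ec S *v 1 \<le> 0"
    using assms(13) by (simp only: at_\<xi> scaled)
  have jump: "closed_loop_jump_matrix S Kd *v \<xi> + sys_Ed S *v 1 \<le> \<xi> - \<epsilon> *\<^sub>R 1"
  proof -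
    have "(sys_J S ** X + sys_Bd S ** Ud - X + \<epsilon> *\<^sub>R mat 1) *v 1
            = closed_loop_jump_matrix S Kd *v \<xi> - \<xi> + \<epsilon> *\<^sub>R 1"
      unfolding at_\<xi> scaled
      by (simp add: \<xi>_def matrix_vector_mult_add_rdistrib matrix_vector_mult_diff_rdistrib
          scaleR_matrix_vector_assoc[symmetric])
    with assms(14) have "closed_loop_jump_matrix S Kd *v \<xi> - \<xi> + \<epsilon> *\<^sub>R 1 + sys_Ed S *v 1 \<le> 0"
      by (simp only:)
    moreover have "a - b + c + d \<le> 0 \<Longrightarrow> a + d \<le> b - c" for a b c d :: "real ^ 'n"
      by (simp add: algebra_simps)
    ultimately show ?thesis by blast
  qed
  have outc: "(sys_Cc S + sys_Dc S ** Kc) *v \<xi> + sys_Fc S *v 1 \<le> \<gamma> *\<^sub>R 1"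
    using assms(15) unfolding at_\<xi> scaled by (simp only: diff_le_0_iff_le)
  have outd: "(sys_Cd S + sys_Dd S ** Kd) *v \<xi> + sys_Fd S *v 1 \<le> \<gamma> *\<^sub>R 1"
    using assms(16) unfolding at_\<xi> scaled by (simp only: diff_le_0_iff_le)
  have nonneg_image: "0 \<le> P *v v" if "0 \<le> P" "0 \<le> v" for P :: "real ^ 'k ^ 'l" and v
    using that by (auto simp: less_eq_vec_def matrix_vector_mult_def intro!: sum_nonneg)
  have one: "0 \<le> (1 :: real ^ 'k)" by (simp add: less_eq_vec_def)
  have "0 \<le> sys_Ec S *v 1" "0 \<le> sys_Ed S *v 1"
    by (intro nonneg_image assms one)+
  with flow jump have flow': "closed_loop_flow_matrix S Kc *v \<xi> \<le> 0"
    and jump': "closed_loop_jump_matrix S Kd *v \<xi> \<le> \<xi> - \<epsilon> *\<^sub>R 1"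
    by (meson add_increasing2 le_add_same_cancel1 order_trans)+
  \<comment> \<open>Nonnegativity of the jump matrix turns the contraction inequality into a lower bound on \<open>\<xi>\<close>.\<close>
  have "0 \<le> closed_loop_jump_matrix S Kd *v \<xi>"
  proof -
    have "0 \<le> closed_loop_jump_matrix S Kd ** X" using assms(10) by (simp only: scaled)
    then show ?thesis unfolding at_\<xi> by (intro nonneg_image one)
  qed
  then have "0 \<le> \<xi> - \<epsilon> *\<^sub>R 1" using jump' by order
  then have \<xi>: "\<epsilon> \<le> \<xi> $ i" for i by (auto simp: less_eq_vec_def)
  have "closed_loop_asymptotically_stable S Kc Kd t" if "impulse_times t" for t
    by (rule closed_loop_asymptotically_stable_if_jumps_shrink
        [OF that M J assms(1,3) flow' jump' \<open>\<epsilon> > 0\<close> \<xi>])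
  moreover have "hybrid_gain S Kc Kd \<le> ereal \<gamma>"
  proof (rule hybrid_gain_le_if_box_invariant[OF M J assms(1,3,2,4) C flow _ outc outd])
    show "0 \<le> \<xi>" using \<xi> \<open>\<epsilon> > 0\<close> by (auto simp: less_eq_vec_def intro: order_trans less_imp_le)
    have "\<xi> - \<epsilon> *\<^sub>R 1 \<le> \<xi>" using \<open>\<epsilon> > 0\<close> by (auto simp: less_eq_vec_def)
    with jump show "closed_loop_jump_matrix S Kd *v \<xi> + sys_Ed S *v 1 \<le> \<xi>" by order
  qed
  ultimately show ?thesis unfolding Kc_def Kd_def by blast
qed

end
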